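(* Let $m_0,d,n\ge 1$ be integers with $\gcd(m_0,d,n)=1$, let $m_i=m_0+id$ for $i=1,2,3$, and let $H=\langle m_0,m_1,m_2,m_3,n\rangle$ be the numerical semigroup generated by $m_0,m_1,m_2,m_3,n$. Assume that $\{m_0,m_1,m_2,m_3,n\}$ is a minimal generating set of $H$ and that $H$ is symmetric. Let $k$ be a field. Then the defining ideal $I(H)\subset k[x_0,x_1,x_2,x_3,x_4]$ of $k[H]$ has a minimal generating set consisting of $\mathrm{RF}$-relations.
   Context: Let $H$ be a numerical semigroup minimally generated by $a_0,\dots,a_e$ (here the generators are taken in the order $m_0,m_1,m_2,m_3,n$). A pseudo-Frobenius number of $H$ is an element $f\in\mathbb Z\setminus H$ with $f+h\in H$ for all $h\in H\setminus\{0\}$; the set of these is $\mathrm{PF}(H)$. $H$ is symmetric if $|\mathrm{PF}(H)|=1$. Defining ideal: for a field $k$, $k[H]=k[t^{a_0},\dots,t^{a_e}]\subset k[t]$, and $I(H)$ is the kernel of the $k$-algebra map $\pi:k[x_0,\dots,x_e]\to k[H]$, $\pi(x_i)=t^{a_i}$. RF-matrix: for $f\in\mathrm{PF}(H)$, an $\mathrm{RF}$-matrix for $f$, denoted $\mathrm{RF}(f)$, is a matrix $A=(a_{ij})_{0\le i,j\le e}$ with integer entries such that $a_{ii}=-1$ for all $i$, $a_{ij}\in\mathbb N=\{0,1,2,\dots\}$ for $i\ne j$, and $\sum_{j} a_{ij}a_j=f$ for every $i$ (where $a_j$ with a single index is the generator). It need not be unique. RF-relations: for $b\in\mathbb Z^{e+1}$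 let $b^+$ be the vector with $i$-th entry $\max(b_i,0)$ and $b^-=b^+-b$. If $\delta_1,\dots,\delta_{e+1}$ are the rows of some $\mathrm{RF}$-matrix for $f\in\mathrm{PF}(H)$ and $\delta_{(ij)}=\delta_j-\delta_i$ for $i<j$, the binomial $\phi_{ij}=\mathbf x^{\delta_{(ij)}^+}-\mathbf x^{\delta_{(ij)}^-}\in I(H)$ is called an $\mathrm{RF}(f)$-relation. An $\mathrm{RF}$-relation is an $\mathrm{RF}(f)$-relation for some $f\in \mathrm{PF}(H)$ (and some $\mathrm{RF}$-matrix for $f$; different relations may come from different $\mathrm{RF}$-matrices). *)

theory Defs
  imports
    "HOL-Library.Poly_Mapping"
    "HOL-Library.Numeral_Type"
    "HOL-Computational_Algebra.Polynomial"
begin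

text \<open>
  A family of generators is a function \<open>a :: 'i \<Rightarrow> nat\<close> on a finite linearly ordered index type.
\<close>

inductive_set semigroup_gen :: "nat set \<Rightarrow> nat set" for A :: "nat set" where
  zero: "0 \<in> semigroup_gen A"
| add: "x \<in> A \<Longrightarrow> h \<in> semigroup_gen A \<Longrightarrow> x + h \<in> semigroup_gen A"

text \<open>
  Minimality is required of the family: no proper subfamily generates \<open>H\<close>. In particular the
  generators are pairwise distinct.
\<close>

definition minimally_generates :: "('i \<Rightarrow> nat) \<Rightarrow> nat set \<Rightarrow> bool" where
  "minimally_generates a H \<longleftrightarrow>
     semigroup_gen (range a) = H \<and> (\<forall>J. J \<subset> UNIV \<longrightarrow> semigroup_gen (a ` J) \<noteq> H)"

definition PF :: "nat set \<Rightarrow> int set" where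
  "PF H = {f. f \<notin> int ` H \<and> (\<forall>h \<in> H - {0}. f + int h \<in> int ` H)}"

definition symmetric_semigroup :: "nat set \<Rightarrow> bool" where
  "symmetric_semigroup H \<longleftrightarrow> card (PF H) = 1"

text \<open>
  The polynomial ring over \<open>'k\<close> with one variable for each element of \<open>'i\<close>: exponent vectors are
  \<open>'i \<Rightarrow>\<^sub>0 nat\<close>, and a polynomial maps each of them to its coefficient.
\<close>

type_synonym ('i, 'k) mpoly = "('i \<Rightarrow>\<^sub>0 nat) \<Rightarrow>\<^sub>0 'k"

definition var :: "'i \<Rightarrow> ('i, 'k::field) mpoly" where
  "var i = Poly_Mapping.single (Poly_Mapping.single i 1) 1"

text \<open>The evaluation homomorphism over \<open>'k\<close> sending \<open>var i\<close> to \<open>t ^ a i\<close>.\<close>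

definition param_hom :: "('i::finite \<Rightarrow> nat) \<Rightarrow> ('i, 'k::field) mpoly \<Rightarrow> 'k poly" where
  "param_hom a p =
     (\<Sum>m \<in> Poly_Mapping.keys p.
        [:Poly_Mapping.lookup p m:] * (\<Prod>i\<in>UNIV. monom 1 (a i) ^ Poly_Mapping.lookup m i))"

definition defining_ideal :: "('i::finite \<Rightarrow> nat) \<Rightarrow> ('i, 'k::field) mpoly set" where
  "defining_ideal a = {p. param_hom a p = 0}"

text \<open>A commutative ring as a module over itself: \<open>ideal.span G\<close> is the ideal generated by \<open>G\<close>.\<close>

interpretation ideal: module "(*) :: 'r::comm_ring_1 \<Rightarrow> 'r \<Rightarrow> 'r"
  by standard (simp_all add: algebra_simps)

definition minimal_ideal_generators :: "'r::comm_ring_1 set \<Rightarrow> 'r set \<Rightarrow> bool" where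
  "minimal_ideal_generators G I \<longleftrightarrow> ideal.span G = I \<and> (\<forall>G'. G' \<subset> G \<longrightarrow> ideal.span G' \<noteq> I)"

definition is_RF_matrix :: "('i::finite \<Rightarrow> nat) \<Rightarrow> int \<Rightarrow> ('i \<Rightarrow> 'i \<Rightarrow> int) \<Rightarrow> bool" where
  "is_RF_matrix a f A \<longleftrightarrow>
     (\<forall>i. A i i = -1) \<and> (\<forall>i j. i \<noteq> j \<longrightarrow> A i j \<ge> 0) \<and>
     (\<forall>i. (\<Sum>j\<in>UNIV. A i j * int (a j)) = f)"

definition pos_part :: "('i \<Rightarrow> int) \<Rightarrow> 'i \<Rightarrow> int" where
  "pos_part b = (\<lambda>i. max (b i) 0)"

definition neg_part :: "('i \<Rightarrow> int) \<Rightarrow> 'i \<Rightarrow> int" where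
  "neg_part b = (\<lambda>i. pos_part b i - b i)"

text \<open>Only applied to non-negative \<open>b\<close>.\<close>

definition monomial :: "('i::finite \<Rightarrow> int) \<Rightarrow> ('i, 'k::field) mpoly" where
  "monomial b = (\<Prod>i\<in>UNIV. var i ^ nat (b i))"

definition RF_binomial :: "('i::finite \<Rightarrow> 'i \<Rightarrow> int) \<Rightarrow> 'i \<Rightarrow> 'i \<Rightarrow> ('i, 'k::field) mpoly" where
  "RF_binomial A i j =
     (let \<delta> = (\<lambda>l. A j l - A i l) in monomial (pos_part \<delta>) - monomial (neg_part \<delta>))"

definition RF_relations :: "('i::{finite,linorder} \<Rightarrow> nat) \<Rightarrow> ('i, 'k::field) mpoly set" where
  "RF_relations a =
     {RF_binomial A i j | f A i j.
        f \<in> PF (semigroup_gen (range a)) \<and> is_RF_matrix a f A \<and> i < j}"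

end

theory Submission
  imports Defs "HOL-Library.FuncSet"
begin

text \<open>
  Let \<open>f\<close> be the unique pseudo-Frobenius number, so that \<open>f - z \<in> H\<close> for every integer \<open>z \<notin> H\<close>.
  The ideal is spanned by binomials \<open>u - v\<close> of monomials of equal weight \<open>D\<close>, and these are reduced
  by induction on \<open>D\<close>. A common variable of \<open>u\<close> and \<open>v\<close> can be divided out. Otherwise choose
  \<open>x\<^sub>i\<close> dividing \<open>u\<close> and \<open>x\<^sub>j\<close> dividing \<open>v\<close>. If \<open>D - a i - a j \<in> H\<close>, some monomial \<open>w\<close> of weight \<open>D\<close>
  is divisible by \<open>x\<^sub>i x\<^sub>j\<close>, and both terms of \<open>(u - w) + (w - v)\<close> have a common variable. If
  \<open>D - a i - a j \<notin> H\<close>, symmetry makes \<open>u - v\<close> an RF-relation up to sign.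
\<close>

subsection \<open>Numerical semigroups\<close>

lemma semigroup_gen_add:
  assumes "x \<in> semigroup_gen A" and "y \<in> semigroup_gen A"
  shows "x + y \<in> semigroup_gen A"
  using assms by induction (auto simp: add.assoc intro: semigroup_gen.add)

lemma semigroup_gen_mult: "x \<in> semigroup_gen A \<Longrightarrow> k * x \<in> semigroup_gen A"
  by (induction k) (auto intro: semigroup_gen.zero semigroup_gen_add)

lemma semigroup_gen_generator: "x \<in> A \<Longrightarrow> x \<in> semigroup_gen A"
  using semigroup_gen.add[OF _ semigroup_gen.zero] by fastforce

text \<open>Write \<open>N = s * q + r * (q + 1)\<close> with \<open>r = N mod q\<close> and
  \<open>s = N div q - r\<close>. The bound \<open>N \<ge> q * q\<close> gives
  \<open>N div q \<ge> q > r\<close>, so \<open>s\<close> is a natural number. For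
  \<open>q = 0\<close> the semigroup contains 1.\<close>

lemma semigroup_gen_ge:
  assumes q: "q \<in> semigroup_gen A" and q1: "q + 1 \<in> semigroup_gen A" and N: "N \<ge> q * q"
  shows "N \<in> semigroup_gen A"
proof (cases "q = 0")
  case True
  then show ?thesis using semigroup_gen_mult[OF q1, of N] by simp
next
  case False
  then have "N mod q \<le> N div q"
    by (metis N div_le_mono mod_less_divisor nonzero_mult_div_cancel_right not_gr_zero
        order.trans less_imp_le)
  then obtain s where s: "N div q = s + N mod q"
    by (metis add.commute le_Suc_ex)
  have "N = (N div q) * q + N mod q" by simp
  also have "\<dots> = s * q + (N mod q) * (q + 1)" unfolding s by (simp add: algebra_simps)
  finally show ?thesis using semigroup_gen_mult[OF q] semigroup_gen_mult[OF q1] semigroup_gen_add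
    by metis
qed

text \<open>Differences of semigroup elements form a subgroup of the integers. This lets Bezout's
  identity be applied inside it.\<close>

lemma semigroup_gen_differences_closed:
  fixes x y s t :: int
  assumes "\<exists>p\<in>semigroup_gen A. \<exists>q\<in>semigroup_gen A. x = int p - int q"
    and "\<exists>p\<in>semigroup_gen A. \<exists>q\<in>semigroup_gen A. y = int p - int q"
  shows "\<exists>p\<in>semigroup_gen A. \<exists>q\<in>semigroup_gen A. s * x + t * y = int p - int q"
proof -
  define D where "D = {z. \<exists>p\<in>semigroup_gen A. \<exists>q\<in>semigroup_gen A. z = int p - int q}"
  have add: "z + w \<in> D" if "z \<in> D" "w \<in> D" for z w
  proof -
    from that obtain p q p' q' where "p \<in> semigroup_gen A" "q \<in> semigroup_gen A"
      "p' \<in> semigroup_gen A" "q' \<in> semigroup_gen A" "z = int p - int q" "w = int p' - int q'"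
      unfolding D_def by blast
    then have "p + p' \<in> semigroup_gen A" "q + q' \<in> semigroup_gen A"
      "z + w = int (p + p') - int (q + q')"
      by (auto intro: semigroup_gen_add)
    then show ?thesis unfolding D_def by blast
  qed
  have minus: "- z \<in> D" if z: "z \<in> D" for z
  proof -
    from z obtain p q where "p \<in> semigroup_gen A" "q \<in> semigroup_gen A" "- z = int q - int p"
      unfolding D_def by force
    then show ?thesis unfolding D_def by blast
  qed
  have scale_nat: "int k * z \<in> D" if "z \<in> D" for k z
  proof (induction k)
    case 0
    show ?case unfolding D_def using semigroup_gen.zero by force
  next
    case (Suc k)
    then show ?case using add[OF that Suc] by (simp add: algebra_simps)
  qed
  have scale: "k * z \<in> D" if "z \<in> D" for k z
    by (cases k rule: int_cases2) (use scale_nat[OF that] minus in auto)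
  have "x \<in> D" "y \<in> D" using assms unfolding D_def by auto
  then have "s * x + t * y \<in> D" by (intro add scale)
  then show ?thesis unfolding D_def by simp
qed

text \<open>Cofiniteness bounds the \<open>h\<close> in the semigroup for which \<open>z + h\<close>
  stays outside. The largest one works, since adding a nonzero element to it must lead into the
  semigroup.\<close>

lemma PF_maximal:
  assumes cofinite: "\<And>N. N \<ge> C \<Longrightarrow> N \<in> semigroup_gen A"
    and z: "z \<notin> int ` semigroup_gen A"
  shows "\<exists>h\<in>semigroup_gen A. z + int h \<in> PF (semigroup_gen A)"
proof -
  define S where "S = {h \<in> semigroup_gen A. z + int h \<notin> int ` semigroup_gen A}"
  have "h \<le> C + nat \<bar>z\<bar>" if "h \<in> S" for h
  proof (rule ccontr)
    assume "\<not> h \<le> C + nat \<bar>z\<bar>"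
    then have "z + int h = int (nat (z + int h))" "nat (z + int h) \<ge> C" by auto
    then have "z + int h \<in> int ` semigroup_gen A" using cofinite by blast
    then show False using that unfolding S_def by simp
  qed
  then have fin: "finite S" by (meson finite_nat_set_iff_bounded_le)
  have "0 \<in> S" using z semigroup_gen.zero unfolding S_def by simp
  then have M: "Max S \<in> S" using fin Max_in by blast
  have "z + int (Max S) + int h \<in> int ` semigroup_gen A"
    if h: "h \<in> semigroup_gen A - {0}" for h
  proof (rule ccontr)
    assume "z + int (Max S) + int h \<notin> int ` semigroup_gen A"
    then have "Max S + h \<in> S"
      using M h semigroup_gen_add unfolding S_def by (auto simp: add.assoc)
    then show False using Max_ge[OF fin] h by fastforce
  qed
  then have "z + int (Max S) \<in> PF (semigroup_gen A)" using M unfolding S_def PF_def by blast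
  then show ?thesis using M unfolding S_def by blast
qed

subsection \<open>Monomials and the defining ideal\<close>

text \<open>The degree for the grading in which the variable \<open>i\<close> has degree
  \<open>a i\<close>, that is, the exponent of \<open>t\<close> in the image of the
  monomial.\<close>

definition weight :: "('i::finite \<Rightarrow> nat) \<Rightarrow> ('i \<Rightarrow>\<^sub>0 nat) \<Rightarrow> nat" where
  "weight a m = (\<Sum>i\<in>UNIV. Poly_Mapping.lookup m i * a i)"

lemma weight_zero [simp]: "weight a 0 = 0"
  by (simp add: weight_def)

lemma weight_add [simp]: "weight a (m + m') = weight a m + weight a m'"
  by (simp add: weight_def lookup_add algebra_simps sum.distrib)

lemma weight_single [simp]: "weight a (Poly_Mapping.single i k) = k * a i"
  by (simp add: weight_def lookup_single when_def if_distrib[of "\<lambda>x. x * _"] cong: if_cong)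

text \<open>Turns membership in the semigroup into the existence of a monomial of given
  weight.\<close>

lemma semigroup_gen_range: "semigroup_gen (range a) = range (weight a)"
proof (intro set_eqI iffI)
  fix h
  assume "h \<in> semigroup_gen (range a)"
  then show "h \<in> range (weight a)"
  proof induction
    case zero
    show ?case using weight_zero[of a] by (metis rangeI)
  next
    case (add x h)
    then obtain i m where "x = a i" "weight a m = h" by blast
    then have "weight a (Poly_Mapping.single i 1 + m) = x + h" by simp
    then show ?case by (metis rangeI)
  qed
next
  fix h
  assume "h \<in> range (weight a)"
  then obtain m where m: "weight a m = h" by blast
  have "(\<Sum>i\<in>I. Poly_Mapping.lookup m i * a i) \<in> semigroup_gen (range a)" if "finite I" for I
    using that
    by induction (simp_all add: semigroup_gen.zero semigroup_gen_add semigroup_gen_mult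
        semigroup_gen_generator)
  from this[of UNIV] show "h \<in> semigroup_gen (range a)" using m unfolding weight_def by simp
qed

lemma exists_monomial_factor:
  assumes "Poly_Mapping.lookup m i > (0::nat)"
  shows "\<exists>m'. m = Poly_Mapping.single i 1 + m'"
proof
  show "m = Poly_Mapping.single i 1 + (m - Poly_Mapping.single i 1)"
    by (rule poly_mapping_eqI)
      (use assms in \<open>auto simp: lookup_add lookup_minus lookup_single when_def\<close>)
qed

lemma exists_lookup_pos: "weight a m > 0 \<Longrightarrow> \<exists>i. Poly_Mapping.lookup m i > 0"
  by (rule ccontr) (simp add: weight_def)

lemma var_power: "var i ^ k = Poly_Mapping.single (Poly_Mapping.single i k) 1"
  by (induction k) (simp_all add: var_def mult_single single_add[symmetric])

lemma monomial_conv_single: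
  fixes m :: "'i::finite \<Rightarrow>\<^sub>0 nat"
  assumes "\<And>i. b i = int (Poly_Mapping.lookup m i)"
  shows "monomial b = (Poly_Mapping.single m 1 :: ('i, 'k::field) mpoly)"
proof -
  have "(\<Prod>i\<in>I. var i ^ Poly_Mapping.lookup m i) =
      (Poly_Mapping.single (\<Sum>i\<in>I. Poly_Mapping.single i (Poly_Mapping.lookup m i)) 1
        :: ('i, 'k) mpoly)" if "finite I" for I
    using that by induction (simp_all add: var_power mult_single)
  moreover have "(\<Sum>i\<in>UNIV. Poly_Mapping.single i (Poly_Mapping.lookup m i)) = m"
    by (rule poly_mapping_eqI) (simp add: lookup_sum lookup_single when_def)
  ultimately show ?thesis unfolding monomial_def assms by simp
qed

text \<open>Any finite superset \<open>S\<close> of the support is allowed, so that several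
  polynomials can be summed over one index set.\<close>

lemma param_hom_conv_weight:
  assumes "finite S" and "Poly_Mapping.keys p \<subseteq> S"
  shows "param_hom a p = (\<Sum>m\<in>S. monom (Poly_Mapping.lookup p m) (weight a m))"
proof -
  have "monom (1::'b) (weight a m) = (\<Prod>i\<in>UNIV. monom 1 (a i) ^ Poly_Mapping.lookup m i)" for m
  proof -
    have "(\<Prod>i\<in>I. monom (1::'b) (a i) ^ Poly_Mapping.lookup m i) =
        monom 1 (\<Sum>i\<in>I. Poly_Mapping.lookup m i * a i)" if "finite I" for I
      using that by induction (simp_all add: mult_monom monom_power mult.commute)
    then show ?thesis unfolding weight_def by simp
  qed
  from this[symmetric] have "param_hom a p =
      (\<Sum>m\<in>Poly_Mapping.keys p. monom (Poly_Mapping.lookup p m) (weight a m))"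
    unfolding param_hom_def by (simp add: smult_monom)
  also have "\<dots> = (\<Sum>m\<in>S. monom (Poly_Mapping.lookup p m) (weight a m))"
    by (rule sum.mono_neutral_left) (use assms in \<open>auto simp: in_keys_iff\<close>)
  finally show ?thesis .
qed

section \<open>The evaluation map as a ring homomorphism, and its kernel\<close>

lemma param_hom_zero [simp]: "param_hom a 0 = 0"
  by (simp add: param_hom_def)

lemma param_hom_add: "param_hom a (p + q) = param_hom a p + param_hom a q"
proof -
  let ?S = "Poly_Mapping.keys p \<union> Poly_Mapping.keys q"
  have "Poly_Mapping.keys (p + q) \<subseteq> ?S" by (rule Poly_Mapping.keys_add)
  then show ?thesis
    by (simp add: param_hom_conv_weight[of ?S] lookup_add add_monom[symmetric] sum.distrib)
qed

lemma param_hom_single: "param_hom a (Poly_Mapping.single m c) = monom c (weight a m)"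
  by (subst param_hom_conv_weight[of "{m}"]) auto

lemma param_hom_sum: "param_hom a (\<Sum>x\<in>S. g x) = (\<Sum>x\<in>S. param_hom a (g x))"
  by (induction S rule: infinite_finite_induct) (simp_all add: param_hom_add)

lemma poly_mapping_conv_sum_single:
  "p = (\<Sum>m\<in>Poly_Mapping.keys p. Poly_Mapping.single m (Poly_Mapping.lookup p m))"
  by (rule poly_mapping_eqI) (auto simp: lookup_sum lookup_single when_def in_keys_iff)

lemma param_hom_mult: "param_hom a (p * q) = param_hom a p * param_hom a q"
proof -
  have "p * q = (\<Sum>m\<in>Poly_Mapping.keys p. \<Sum>m'\<in>Poly_Mapping.keys q.
      Poly_Mapping.single (m + m') (Poly_Mapping.lookup p m * Poly_Mapping.lookup q m'))"
    by (subst poly_mapping_conv_sum_single[of p], subst poly_mapping_conv_sum_single[of q])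
      (simp add: sum_product mult_single)
  then show ?thesis
    by (simp add: param_hom_sum param_hom_single param_hom_conv_weight[OF _ order.refl]
        sum_product mult_monom)
qed

lemma subspace_defining_ideal:
  "ideal.subspace (defining_ideal a :: ('i::finite, 'k::field) mpoly set)"
  by (rule ideal.subspaceI) (simp_all add: defining_ideal_def param_hom_add param_hom_mult)

lemma binomial_in_defining_ideal:
  assumes "weight a u = weight a v"
  shows "Poly_Mapping.single u 1 - Poly_Mapping.single v (1::'k::field) \<in> defining_ideal a"
proof -
  have "Poly_Mapping.single u 1 - Poly_Mapping.single v (1::'k) =
      Poly_Mapping.single u 1 + Poly_Mapping.single v (-1)"
    by (simp add: single_uminus)
  then show ?thesis
    using assms
    by (simp only: defining_ideal_def mem_Collect_eq param_hom_add param_hom_single add_monom) simp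
qed

text \<open>In an element of the kernel the coefficients of each weight sum to 0. Replacing every
  monomial by a fixed one of the same weight therefore gives 0, and subtracting this exhibits
  \<open>p\<close> as a combination of binomials.\<close>

lemma defining_ideal_subset_span:
  fixes G :: "('i::finite, 'k::field) mpoly set"
  assumes G: "\<And>u v. weight a u = weight a v \<Longrightarrow>
      Poly_Mapping.single u 1 - Poly_Mapping.single v 1 \<in> ideal.span G"
  shows "defining_ideal a \<subseteq> ideal.span G"
proof
  fix p :: "('i, 'k) mpoly"
  assume "p \<in> defining_ideal a"
  then have p0: "param_hom a p = 0" by (simp add: defining_ideal_def)
  let ?K = "Poly_Mapping.keys p" and ?c = "Poly_Mapping.lookup p"
  \<comment> \<open>For a weight that no monomial has, \<open>rep D\<close> is unspecified; it is
    only used at weights that occur.\<close>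
  define rep where "rep D = (SOME m. weight a m = D)" for D
  have rep: "weight a (rep (weight a m)) = weight a m" for m
    unfolding rep_def by (rule someI) (rule refl)
  \<comment> \<open>The sum is the coefficient of \<open>t ^ D\<close> in the image of
    \<open>p\<close>.\<close>
  have coeff0: "(\<Sum>m\<in>{m \<in> ?K. weight a m = D}. ?c m) = 0" for D
  proof -
    have "(\<Sum>m\<in>{m \<in> ?K. weight a m = D}. ?c m) = coeff (param_hom a p) D"
      by (simp add: param_hom_conv_weight[OF _ order.refl] coeff_sum coeff_monom
          sum.inter_filter)
    then show ?thesis using p0 by simp
  qed
  have "(\<Sum>m\<in>?K. Poly_Mapping.single (rep (weight a m)) (?c m)) =
      (\<Sum>D\<in>weight a ` ?K. \<Sum>m\<in>{m \<in> ?K. weight a m = D}.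
        Poly_Mapping.single (rep (weight a m)) (?c m))"
    by (rule sum.image_gen) simp
  also have "\<dots> = (\<Sum>D\<in>weight a ` ?K.
      Poly_Mapping.single (rep D) (\<Sum>m\<in>{m \<in> ?K. weight a m = D}. ?c m))"
    by (intro sum.cong refl poly_mapping_eqI) (simp add: lookup_sum lookup_single when_def)
  also have "\<dots> = 0" by (simp add: coeff0)
  finally have zero: "(\<Sum>m\<in>?K. Poly_Mapping.single (rep (weight a m)) (?c m)) = 0" .
  have "p = (\<Sum>m\<in>?K. Poly_Mapping.single m (?c m))" by (rule poly_mapping_conv_sum_single)
  also have "\<dots> = (\<Sum>m\<in>?K. Poly_Mapping.single m (?c m)
      - Poly_Mapping.single (rep (weight a m)) (?c m))"
    by (simp add: sum_subtractf zero)
  \<comment> \<open>\<open>Poly_Mapping.single 0 c\<close> is the constant polynomial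
    \<open>c\<close>.\<close>
  also have "\<dots> = (\<Sum>m\<in>?K. Poly_Mapping.single 0 (?c m) *
      (Poly_Mapping.single m 1 - Poly_Mapping.single (rep (weight a m)) 1))"
    by (simp add: right_diff_distrib mult_single)
  also have "\<dots> \<in> ideal.span G"
    by (intro ideal.span_sum ideal.span_scale G) (simp add: rep)
  finally show "p \<in> ideal.span G" .
qed

text \<open>Descent along proper subsets: a finite generating set that is not minimal has a proper
  subset that still generates.\<close>

lemma finite_generators_minimal:
  assumes "finite S" and "ideal.span S = I"
  shows "\<exists>G\<subseteq>S. minimal_ideal_generators G I"
  using assms
proof (induction S rule: finite_psubset_induct)
  case (psubset S)
  show ?case
  proof (cases "minimal_ideal_generators S I")
    case False
    then obtain S' where "S' \<subset> S" "ideal.span S' = I"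
      using psubset.prems unfolding minimal_ideal_generators_def by blast
    then obtain G where "G \<subseteq> S'" "minimal_ideal_generators G I" using psubset.IH[of S'] by auto
    then show ?thesis using \<open>S' \<subset> S\<close> by (intro exI[of _ G]) auto
  qed blast
qed

subsection \<open>RF-relations\<close>

lemma RF_binomial_conv_single:
  fixes A :: "'i::finite \<Rightarrow> 'i \<Rightarrow> int"
  obtains u v where "(RF_binomial A i j :: ('i, 'k::field) mpoly) =
      Poly_Mapping.single u 1 - Poly_Mapping.single v 1"
    and "\<And>l. int (Poly_Mapping.lookup u l) - int (Poly_Mapping.lookup v l) = A j l - A i l"
proof -
  \<comment> \<open>\<open>nat\<close> cuts negative integers off at 0, so \<open>u\<close> and
    \<open>v\<close> are the positive and negative parts of the row difference.\<close>
  define u where "u = Abs_poly_mapping (\<lambda>l. nat (A j l - A i l))"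
  define v where "v = Abs_poly_mapping (\<lambda>l. nat (A i l - A j l))"
  have u: "Poly_Mapping.lookup u l = nat (A j l - A i l)" for l
    unfolding u_def by (simp add: Abs_poly_mapping_inverse)
  have v: "Poly_Mapping.lookup v l = nat (A i l - A j l)" for l
    unfolding v_def by (simp add: Abs_poly_mapping_inverse)
  have "(RF_binomial A i j :: ('i, 'k) mpoly) =
      Poly_Mapping.single u 1 - Poly_Mapping.single v 1"
    unfolding RF_binomial_def Let_def
    by (intro arg_cong2[where f = minus] monomial_conv_single)
      (auto simp: u v pos_part_def neg_part_def)
  then show ?thesis by (rule that) (auto simp: u v)
qed

lemma RF_relations_subset_defining_ideal:
  "(RF_relations a :: ('i::{finite,linorder}, 'k::field) mpoly set) \<subseteq> defining_ideal a"
proof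
  fix p :: "('i, 'k) mpoly"
  assume "p \<in> RF_relations a"
  then obtain f A i j where A: "is_RF_matrix a f A" and p: "p = RF_binomial A i j"
    unfolding RF_relations_def by blast
  obtain u v where uv: "(RF_binomial A i j :: ('i, 'k) mpoly) = Poly_Mapping.single u 1 - Poly_Mapping.single v 1"
    and diff: "\<And>l. int (Poly_Mapping.lookup u l) - int (Poly_Mapping.lookup v l) = A j l - A i l"
    using RF_binomial_conv_single[of A i j] by metis
  have "int (weight a u) - int (weight a v) =
      (\<Sum>l\<in>UNIV. (int (Poly_Mapping.lookup u l) - int (Poly_Mapping.lookup v l)) * int (a l))"
    by (simp add: weight_def left_diff_distrib sum_subtractf)
  also have "\<dots> = (\<Sum>l\<in>UNIV. A j l * int (a l)) - (\<Sum>l\<in>UNIV. A i l * int (a l))"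
    by (simp add: diff left_diff_distrib sum_subtractf)
  also have "\<dots> = 0" using A by (simp add: is_RF_matrix_def)
  finally show "p \<in> defining_ideal a" using binomial_in_defining_ideal uv p by simp
qed

text \<open>Off the diagonal, row \<open>i\<close> is nonnegative with weighted sum
  \<open>f + int (a i)\<close>. As the generators are positive, this bounds every entry and leaves
  finitely many RF-matrices for each \<open>f\<close>.\<close>

lemma finite_RF_relations:
  fixes a :: "'i::{finite,linorder} \<Rightarrow> nat"
  assumes pos: "\<And>i. a i > 0" and PF: "finite (PF (semigroup_gen (range a)))"
  shows "finite (RF_relations a :: ('i, 'k::field) mpoly set)"
proof -
  have bound: "A i j \<in> {-1 .. \<bar>f\<bar> + int (a i)}" if A: "is_RF_matrix a f A" for f A i j
  proof (cases "j = i")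
    case True
    then show ?thesis using A by (simp add: is_RF_matrix_def)
  next
    case False
    have "f = (\<Sum>l\<in>UNIV. A i l * int (a l))" using A by (simp add: is_RF_matrix_def)
    also have "\<dots> = - int (a i) + (\<Sum>l\<in>UNIV - {i}. A i l * int (a l))"
      using A by (subst sum.remove[of _ i]) (auto simp: is_RF_matrix_def)
    finally have "(\<Sum>l\<in>UNIV - {i}. A i l * int (a l)) = f + int (a i)" by simp
    moreover have "A i j * int (a j) \<le> (\<Sum>l\<in>UNIV - {i}. A i l * int (a l))"
      by (rule member_le_sum) (use False A in \<open>auto simp: is_RF_matrix_def\<close>)
    moreover have nonneg: "A i j \<ge> 0" using False A by (simp add: is_RF_matrix_def)
    moreover have "A i j \<le> A i j * int (a j)"
      using mult_left_mono[of 1 "int (a j)" "A i j"] nonneg pos[of j] by simp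
    ultimately show ?thesis by auto
  qed
  have fin: "finite {A. is_RF_matrix a f A}" for f
  proof (rule finite_subset)
    show "{A. is_RF_matrix a f A} \<subseteq> (UNIV :: 'i set) \<rightarrow>\<^sub>E
        ((UNIV :: 'i set) \<rightarrow>\<^sub>E (\<Union>i. {-1 .. \<bar>f\<bar> + int (a i)}))"
      using bound by fastforce
  qed (auto intro!: finite_PiE)
  have "RF_relations a \<subseteq> (\<Union>f\<in>PF (semigroup_gen (range a)). \<Union>A\<in>{A. is_RF_matrix a f A}.
      \<Union>i. \<Union>j. {RF_binomial A i j :: ('i, 'k) mpoly})"
    unfolding RF_relations_def by blast
  then show ?thesis by (rule finite_subset) (use PF fin in auto)
qed

text \<open>
  By symmetry \<open>f - (D - a i - a j)\<close> is the weight of a monomial \<open>P\<close>; the rows of the RF-matrix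
  are the exponents of \<open>v' P\<close> and \<open>u' P\<close>, and \<open>P\<close> cancels in their difference.
\<close>
lemma RF_relation_of_binomial:
  fixes a :: "'i::{finite,linorder} \<Rightarrow> nat"
  assumes pos: "\<And>i. a i > 0" and f: "f \<in> PF (semigroup_gen (range a))"
    and u: "u = Poly_Mapping.single i 1 + u'" and v: "v = Poly_Mapping.single j 1 + v'"
    and coprime: "\<And>l. Poly_Mapping.lookup u l = 0 \<or> Poly_Mapping.lookup v l = 0"
    and weight: "weight a u = weight a v"
    and P: "int (weight a P) = f - (int (weight a u) - int (a i) - int (a j))"
    and less: "i < j"
  shows "Poly_Mapping.single u 1 - Poly_Mapping.single v 1
    \<in> (RF_relations a :: ('i, 'k::field) mpoly set)"
proof -
  have notin: "f \<notin> int ` semigroup_gen (range a)" using f by (simp add: PF_def)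
  have "\<exists>m. int (weight a m) = f + int (a l)" for l
  proof -
    have "f + int (a l) \<in> int ` semigroup_gen (range a)"
      using f pos[of l] semigroup_gen_generator[of "a l" "range a"] by (auto simp: PF_def)
    then obtain m where "f + int (a l) = int (weight a m)" unfolding semigroup_gen_range by blast
    then show ?thesis by metis
  qed
  then obtain M where M: "\<And>l. int (weight a (M l)) = f + int (a l)" by metis
  \<comment> \<open>\<open>N r\<close> is to be row \<open>r\<close> with its diagonal -1 removed,
    so it needs weight \<open>f + a r\<close>. Only rows \<open>i\<close> and \<open>j\<close> are
    prescribed; \<open>v' + P\<close> has weight \<open>f + a i\<close> and \<open>u' + P\<close>
    has weight \<open>f + a j\<close>.\<close>
  define N where "N = M(i := v' + P, j := u' + P)"
  have N: "int (weight a (N l)) = f + int (a l)" for l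
    using M[of l] P weight less unfolding N_def u v by auto
  \<comment> \<open>If the variable \<open>l\<close> divided \<open>N l\<close>, cancelling it would
    leave a monomial of weight \<open>f\<close>, putting \<open>f\<close> in the semigroup. Hence
    the diagonal entries of \<open>A\<close> are exactly -1.\<close>
  have N0: "Poly_Mapping.lookup (N l) l = 0" for l
  proof (rule ccontr)
    assume "Poly_Mapping.lookup (N l) l \<noteq> 0"
    then obtain m where "N l = Poly_Mapping.single l 1 + m"
      using exists_monomial_factor[of "N l" l] by auto
    then have "f = int (weight a m)" using N[of l] by simp
    then show False using notin unfolding semigroup_gen_range by blast
  qed
  define A where "A r l = int (Poly_Mapping.lookup (N r) l) - (if l = r then 1 else 0)" for r l
  have "is_RF_matrix a f A"
  proof -
    have "(\<Sum>l\<in>UNIV. A r l * int (a l)) = f" for r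
    proof -
      have "(\<Sum>l\<in>UNIV. A r l * int (a l)) = int (weight a (N r)) - int (a r)"
        unfolding A_def weight_def
        by (simp add: left_diff_distrib sum_subtractf if_distrib[of "\<lambda>x. x * _"] cong: if_cong)
      then show ?thesis using N by simp
    qed
    then show ?thesis by (simp add: is_RF_matrix_def A_def N0)
  qed
  then have "(RF_binomial A i j :: ('i, 'k) mpoly) \<in> RF_relations a"
    using f less unfolding RF_relations_def by blast
  moreover have "RF_binomial A i j =
      (Poly_Mapping.single u 1 - Poly_Mapping.single v 1 :: ('i, 'k) mpoly)"
  proof -
    \<comment> \<open>Subtracting the diagonal units restores the factors \<open>i\<close> and
      \<open>j\<close> that were removed from \<open>u\<close> and \<open>v\<close>.\<close>
    have diff: "A j l - A i l = int (Poly_Mapping.lookup u l) - int (Poly_Mapping.lookup v l)" for l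
      using less by (auto simp: A_def N_def u v lookup_add lookup_single when_def)
    \<comment> \<open>Coprimality makes \<open>u\<close> and \<open>v\<close> the positive and
      negative parts of their difference, so no factor is lost.\<close>
    have "max (int x - int y) 0 = int x" "max (int x - int y) 0 - (int x - int y) = int y"
      if "x = 0 \<or> y = 0" for x y
      using that by auto
    then show ?thesis
      unfolding RF_binomial_def Let_def
      by (intro arg_cong2[where f = minus] monomial_conv_single)
        (use coprime in \<open>auto simp: diff pos_part_def neg_part_def\<close>)
  qed
  ultimately show ?thesis by simp
qed

lemma binomial_in_span_RF_relations:
  fixes a :: "'i::{finite,linorder} \<Rightarrow> nat"
  assumes pos: "\<And>i. a i > 0"
    and f: "f \<in> PF (semigroup_gen (range a))"
    and sym: "\<And>z. z \<notin> int ` semigroup_gen (range a) \<Longrightarrow> f - z \<in> int ` semigroup_gen (range a)"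
    and "weight a u = weight a v"
  shows "Poly_Mapping.single u 1 - Poly_Mapping.single v 1
    \<in> ideal.span (RF_relations a :: ('i, 'k::field) mpoly set)"
  using \<open>weight a u = weight a v\<close>
proof (induction "weight a u" arbitrary: u v rule: less_induct)
  case less
  let ?X = "\<lambda>m. Poly_Mapping.single m 1 :: ('i, 'k) mpoly"
  let ?J = "ideal.span (RF_relations a :: ('i, 'k) mpoly set)"
  \<comment> \<open>Dividing by the common variable lowers the weight by \<open>a i > 0\<close>, so
    the induction hypothesis applies to the quotients.\<close>
  have common: "?X u\<^sub>1 - ?X u\<^sub>2 \<in> ?J"
    if u\<^sub>1: "u\<^sub>1 = Poly_Mapping.single i 1 + m\<^sub>1" and u\<^sub>2: "u\<^sub>2 = Poly_Mapping.single i 1 + m\<^sub>2"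
      and w: "weight a u\<^sub>1 = weight a u" "weight a u\<^sub>2 = weight a u" for i u\<^sub>1 u\<^sub>2 m\<^sub>1 m\<^sub>2
  proof -
    have "?X m\<^sub>1 - ?X m\<^sub>2 \<in> ?J"
      by (rule less.hyps) (use u\<^sub>1 u\<^sub>2 w pos[of i] in auto)
    then have "?X (Poly_Mapping.single i 1) * (?X m\<^sub>1 - ?X m\<^sub>2) \<in> ?J" by (rule ideal.span_scale)
    then show ?thesis by (simp add: u\<^sub>1 u\<^sub>2 right_diff_distrib mult_single)
  qed
  \<comment> \<open>Since generators are positive, weight 0 forces the constant monomial; hence
    \<open>u = v\<close> in the base case.\<close>
  have eq_0: "m = 0" if "weight a m = 0" for m
    using that by (intro poly_mapping_eqI) (simp add: weight_def less_imp_neq[OF pos, symmetric])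
  show ?case
  proof (cases "weight a u = 0")
    case True
    then show ?thesis using eq_0 less.prems
      by (metis cancel_comm_monoid_add_class.diff_cancel ideal.span_zero)
  next
    case False
    then obtain i j where ij: "Poly_Mapping.lookup u i > 0" "Poly_Mapping.lookup v j > 0"
      using exists_lookup_pos less.prems by (metis gr0I)
    then obtain u' v' where u: "u = Poly_Mapping.single i 1 + u'"
      and v: "v = Poly_Mapping.single j 1 + v'"
      using exists_monomial_factor by metis
    show ?thesis
    proof (cases "\<forall>l. Poly_Mapping.lookup u l = 0 \<or> Poly_Mapping.lookup v l = 0")
      case False
      then obtain l m\<^sub>1 m\<^sub>2 where "u = Poly_Mapping.single l 1 + m\<^sub>1" "v = Poly_Mapping.single l 1 + m\<^sub>2"
        using exists_monomial_factor by (metis gr0I)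
      then show ?thesis using common less.prems by metis
    next
      case coprime: True
      \<comment> \<open>The weight that a cofactor of the variables \<open>i\<close> and
        \<open>j\<close> must have; it may be negative, hence the integer type.\<close>
      define z where "z = int (weight a u) - int (a i) - int (a j)"
      show ?thesis
      proof (cases "z \<in> int ` semigroup_gen (range a)")
        case True
        then obtain m where m: "z = int (weight a m)" unfolding semigroup_gen_range by blast
        define w where "w = Poly_Mapping.single i 1 + (Poly_Mapping.single j 1 + m)"
        have w': "w = Poly_Mapping.single j 1 + (Poly_Mapping.single i 1 + m)"
          unfolding w_def by (simp add: ac_simps)
        have "int (weight a w) = int (weight a u)" using m unfolding w_def z_def by simp
        then have ww: "weight a w = weight a u" by simp
        have "(?X u - ?X w) + (?X w - ?X v) \<in> ?J"
          by (rule ideal.span_add[OF common[OF u w_def refl ww]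
                common[OF w' v ww less.prems[symmetric]]])
        then show ?thesis by simp
      next
        case False
        then obtain P where P: "f - z = int (weight a P)"
          using sym[OF False] unfolding semigroup_gen_range by blast
        have "i \<noteq> j" using ij coprime[THEN spec, of i] by auto
        then consider "i < j" | "j < i" by (rule linorder_neqE)
        then show ?thesis
        proof cases
          case 1
          have "?X u - ?X v \<in> RF_relations a"
            by (rule RF_relation_of_binomial[OF pos f u v _ less.prems _ 1])
              (use coprime P z_def in auto)
          then show ?thesis by (rule ideal.span_base)
        next
          case 2
          \<comment> \<open>RF-relations take the smaller row index first, so \<open>u\<close> and
            \<open>v\<close> exchange roles and the sign is corrected afterwards.\<close>
          have "?X v - ?X u \<in> RF_relations a"
          proof (rule RF_relation_of_binomial[OF pos f v u _ less.prems[symmetric] _ 2])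
            show "Poly_Mapping.lookup v l = 0 \<or> Poly_Mapping.lookup u l = 0" for l
              using coprime[THEN spec, of l] by (rule disj_commute[THEN iffD1])
            show "int (weight a P) = f - (int (weight a v) - int (a j) - int (a i))"
              using P less.prems unfolding z_def by simp
          qed
          then have "- (?X v - ?X u) \<in> ?J" by (intro ideal.span_neg ideal.span_base)
          then show ?thesis by simp
        qed
      qed
    qed
  qed
qed

theorem theorem5p5:
  fixes m0 d n :: nat and a :: "5 \<Rightarrow> nat" and H :: "nat set"
  assumes "m0 \<ge> 1" and "d \<ge> 1" and "n \<ge> 1"
    and "gcd m0 (gcd d n) = 1"
    and "a 0 = m0" and "a 1 = m0 + d" and "a 2 = m0 + 2 * d" and "a 3 = m0 + 3 * d" and "a 4 = n"
    and "H = semigroup_gen (range a)"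
    and "minimally_generates a H"
    and "symmetric_semigroup H"
  shows "\<exists>G :: (5, 'k::field) mpoly set.
           G \<subseteq> RF_relations a \<and> minimal_ideal_generators G (defining_ideal a)"
proof -
  note H = \<open>H = semigroup_gen (range a)\<close>
  have pos: "a i > 0" for i
  proof (cases i)
    case (of_int z)
    then have "z = 0 \<or> z = 1 \<or> z = 2 \<or> z = 3 \<or> z = 4" by auto
    then show ?thesis using of_int assms by auto
  qed
  let ?diff = "\<lambda>x. \<exists>p\<in>semigroup_gen (range a). \<exists>q\<in>semigroup_gen (range a). x = int p - int q"
  have gen: "a i \<in> semigroup_gen (range a)" for i by (simp add: semigroup_gen_generator)
  have dm: "?diff (int m0)" and dn: "?diff (int n)"
    using gen[of 0] gen[of 4] semigroup_gen.zero assms by force+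
  have dd: "?diff (int d)"
    using gen[of 0] gen[of 1] assms by force
  \<comment> \<open>Two applications of Bezout's identity put 1 in the group of differences, which
    contains \<open>m0\<close>, \<open>n\<close> and \<open>d\<close>, the last as
    \<open>a 1 - a 0\<close>.\<close>
  obtain s t where st: "s * int d + t * int n = gcd (int d) (int n)"
    using bezout_int[of "int d" "int n"] by blast
  obtain s' t' where
    st': "s' * int m0 + t' * gcd (int d) (int n) = gcd (int m0) (gcd (int d) (int n))"
    using bezout_int[of "int m0" "gcd (int d) (int n)"] by blast
  have "gcd (int m0) (gcd (int d) (int n)) = 1"
    using assms(4) by (metis gcd_int_int_eq of_nat_1)
  then have "?diff 1"
    using semigroup_gen_differences_closed[OF dm, of "gcd (int d) (int n)" s' t']
      semigroup_gen_differences_closed[OF dd dn, of s t] st st' by simp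
  \<comment> \<open>A representation of 1 as a difference is a pair of consecutive semigroup
    elements, which yields cofiniteness.\<close>
  then obtain q where q: "q \<in> semigroup_gen (range a)" "q + 1 \<in> semigroup_gen (range a)"
    by (metis add.commute diff_eq_eq of_nat_1 of_nat_add of_nat_eq_iff)
  obtain f where f: "PF (semigroup_gen (range a)) = {f}"
    using \<open>symmetric_semigroup H\<close> H card_1_singletonE unfolding symmetric_semigroup_def by blast
  \<comment> \<open>Some \<open>z + h\<close> with \<open>h\<close> in the semigroup is
    pseudo-Frobenius, hence equals \<open>f\<close>, so \<open>f - z = h\<close>.\<close>
  have sym: "f - z \<in> int ` semigroup_gen (range a)" if "z \<notin> int ` semigroup_gen (range a)" for z
    using PF_maximal[of "q * q", OF semigroup_gen_ge[OF q] that] f by fastforce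
  have "ideal.span (RF_relations a) = (defining_ideal a :: (5, 'k) mpoly set)"
  proof
    show "ideal.span (RF_relations a) \<subseteq> (defining_ideal a :: (5, 'k) mpoly set)"
      by (rule ideal.span_minimal[OF RF_relations_subset_defining_ideal subspace_defining_ideal])
    show "(defining_ideal a :: (5, 'k) mpoly set) \<subseteq> ideal.span (RF_relations a)"
      by (intro defining_ideal_subset_span binomial_in_span_RF_relations) (use pos f sym in auto)
  qed
  moreover have "finite (RF_relations a :: (5, 'k) mpoly set)"
    by (rule finite_RF_relations) (use pos f in auto)
  ultimately show ?thesis using finite_generators_minimal by blast
qed

end
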